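(* Let $\alpha=(a_1,a_2,\dots)$ and $\beta=(b_0,b_1,\dots)$ be sequences of positive integers, let $k_1=b_1/a_1$ and recursively $k_n=\frac{b_nb_{n-1}}{a_nk_{n-1}}$ for $n>1$, and let $A_n/B_n$ be the $n$-th convergent of the generalised continued fraction $$b_0+\cfrac{a_1}{b_1+\cfrac{a_2}{b_2+\cfrac{a_3}{b_3+\cdots}}}.$$ For the space $X(\alpha,\beta)$: (1) If $\sum_{n=1}^\infty k_n$ diverges, then with $\ell=\lim_{n}\frac{A_n}{B_n}$, the homology core at place zero is $$\bigcap_{n\in\mathbb{N}}M_0^n(\mathcal{C}_n)=\mathrm{span}\begin{pmatrix}\ell \\ 1\end{pmatrix}.$$ (2) If $\sum_{n=1}^\infty k_n$ converges, then with $\ell_E=\lim_n\frac{A_{2n}}{B_{2n}}$ and $\ell_O=\lim_n\frac{A_{2n-1}}{B_{2n-1}}$, the homology core at place zero $\bigcap_{n\in\mathbb{N}}M_0^n(\mathcal{C}_n)$ is the union of the two sectors in $V_0$ bounded by $\mathrm{span}\begin{pmatrix}\ell_E \\ 1\end{pmatrix}$ and $\mathrm{span}\begin{pmatrix}\ell_O \\ 1\end{pmatrix}$, namely the set of all $x\begin{pmatrix}\ell_E \\ 1\end{pmatrix}+y\begin{pmatrix}\ell_O \\ 1\end{pmatrix}$ with $x,y\ge0$ or $x,y\le0$.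
   Context: Let $K$ be the oriented one-dimensional CW complex (graph) with two vertices $s,t$ and three oriented edges: $a$ from $s$ to $t$, $b$ from $s$ to $t$, and $c$ from $t$ to $s$. For positive integers $m,n$ let $f_{m,n}:K\to K$ be the map which interchanges $s$ and $t$ and maps each edge, preserving orientation, onto the following edge paths (traversed from left to right): $$a\mapsto c,\qquad b\mapsto\underbrace{ca\cdots ca}_{m\text{ copies}}\,\underbrace{cb\cdots cb}_{n-1\text{ copies}}\,c,\qquad c\mapsto b.$$ Define $X(\alpha,\beta)=\varprojlim\{K\xleftarrow{f_{1,b_0}}K\xleftarrow{f_{a_1,b_1}}K\xleftarrow{f_{a_2,b_2}}K\leftarrow\cdots\}$, with the copies of $K$ indexed by $0,1,2,\dots$. As generators of $H_1(K;\mathbb{Z})\cong\mathbb{Z}\oplus\mathbb{Z}$ take the classes of the cycles $z_1\sim cb$ and $z_2\sim ca$. With respect to these generators $(f_{m,n})_*$ is represented by $\begin{pmatrix} n & 1 \\ m & 0 \end{pmatrix}$. For the $n$-th copy of $K$ let $V_n=H_1(K;\mathbb{R})\cong\mathbb{R}^2$ with this basis, and let $\mathcal{C}_n\subset V_n$ be the positive and negative cone: the set of all finite combinations $\sum r_ix_i$ with either all $r_i\ge0$ or all $r_i\le0$, where the $x_i$ are positive homology classes, i.e. classes represented by non-negative integer combinations of positively oriented edges of (subdivisions of) $K$. Put $a_0=1$ and let $$M_0^n=\begin{pmatrix} b_0 & 1 \\ a_0 & 0 \end{pmatrix}\begin{pmatrix} b_1 & 1 \\ a_1 & 0 \end{pmatrix}\cdots\begin{pmatrix}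 b_{n-1} & 1 \\ a_{n-1} & 0 \end{pmatrix}:V_n\to V_0.$$ The homology core at place zero is $\bigcap_{n\in\mathbb{N}}M_0^n(\mathcal{C}_n)\subset V_0$. The numerators and denominators $A_k,B_k$ of the convergents are given by $$\begin{pmatrix} b_0 & 1 \\ 1 & 0 \end{pmatrix}\begin{pmatrix} b_1 & 1 \\ a_1 & 0 \end{pmatrix}\cdots\begin{pmatrix} b_k & 1 \\ a_k & 0 \end{pmatrix}=\begin{pmatrix} A_k & A_{k-1} \\ B_k & B_{k-1} \end{pmatrix}.$$ *)

theory Defs
  imports "HOL-Analysis.Analysis"
begin

subsection \<open>The graph \<open>K\<close> and its homology\<close>

datatype vertex = Vs | Vt

datatype edge = Ea | Eb | Ec

lemma UNIV_edge: "UNIV = {Ea, Eb, Ec}"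
  using edge.exhaust by auto

instance edge :: finite
  by standard (simp add: UNIV_edge)

fun src :: "edge \<Rightarrow> vertex" where
  "src Ea = Vs" | "src Eb = Vs" | "src Ec = Vt"

fun tgt :: "edge \<Rightarrow> vertex" where
  "tgt Ea = Vt" | "tgt Eb = Vt" | "tgt Ec = Vs"

text \<open>Cellular chains of \<open>K\<close> with real coefficients are functions on the edges. As \<open>K\<close> has no
  cells of dimension two, \<open>H\<^sub>1(K; \<real>)\<close> is the space of cycles.\<close>

definition boundary :: "(edge \<Rightarrow> real) \<Rightarrow> vertex \<Rightarrow> real" where
  "boundary x v = (\<Sum>e | tgt e = v. x e) - (\<Sum>e | src e = v. x e)"

definition H1 :: "(edge \<Rightarrow> real) set" where
  "H1 = {x. \<forall>v. boundary x v = 0}"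

definition path_chain :: "edge list \<Rightarrow> edge \<Rightarrow> real" where
  "path_chain p e = real (count_list p e)"

abbreviation z1 :: "edge \<Rightarrow> real" where "z1 \<equiv> path_chain [Ec, Eb]"
abbreviation z2 :: "edge \<Rightarrow> real" where "z2 \<equiv> path_chain [Ec, Ea]"

text \<open>The identification of \<open>\<real>\<^sup>2\<close> with \<open>H\<^sub>1(K; \<real>)\<close> given by the basis \<open>z1, z2\<close>.\<close>

definition of_coords :: "real ^ 2 \<Rightarrow> edge \<Rightarrow> real" where
  "of_coords v = (\<lambda>e. v $ 1 * z1 e + v $ 2 * z2 e)"

definition to_coords :: "(edge \<Rightarrow> real) \<Rightarrow> real ^ 2" where
  "to_coords = inv_into UNIV of_coords"

text \<open>A class is positive if, after subdividing every edge \<open>e\<close> into \<open>N e\<close> edges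
  \<open>(e, 0), \<dots>, (e, N e - 1)\<close>, it is represented by a combination of these edges with coefficients
  \<open>y e j\<close> in the natural numbers. Subdivision sends the chain \<open>x\<close> to the chain with
  coefficient \<open>x e\<close> on each \<open>(e, j)\<close>, and homologous cycles are equal.\<close>

definition positive_class :: "(edge \<Rightarrow> real) \<Rightarrow> bool" where
  "positive_class x \<longleftrightarrow> x \<in> H1 \<and>
     (\<exists>(N :: edge \<Rightarrow> nat) (y :: edge \<Rightarrow> nat \<Rightarrow> nat).
        (\<forall>e. 0 < N e) \<and> (\<forall>e. \<forall>j < N e. x e = real (y e j)))"

definition pn_cone :: "(real ^ 2) set" where
  "pn_cone = {\<Sum>i<k. r i *\<^sub>R x i | (k :: nat) (r :: nat \<Rightarrow> real) (x :: nat \<Rightarrow> real ^ 2).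
     (\<forall>i<k. positive_class (of_coords (x i))) \<and> ((\<forall>i<k. 0 \<le> r i) \<or> (\<forall>i<k. r i \<le> 0))}"


subsection \<open>Inverse sequences of graph maps and the homology core\<close>

text \<open>An orientation preserving map \<open>K \<rightarrow> K\<close> is given by the positive edge path to which it maps
  each edge.\<close>

type_synonym graph_map = "edge \<Rightarrow> edge list"

definition chain_map :: "graph_map \<Rightarrow> (edge \<Rightarrow> real) \<Rightarrow> edge \<Rightarrow> real" where
  "chain_map f x = (\<lambda>e'. \<Sum>e\<in>UNIV. x e * path_chain (f e) e')"

definition induced :: "graph_map \<Rightarrow> real ^ 2 \<Rightarrow> real ^ 2" where
  "induced f = to_coords \<circ> chain_map f \<circ> of_coords"

text \<open>For an inverse sequence with \<open>F i\<close> mapping the copy of \<open>K\<close> with index \<open>i + 1\<close> to the one with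
  index \<open>i\<close>, the following is the homomorphism \<open>V\<^sub>n \<rightarrow> V\<^sub>0\<close>.\<close>

primrec induced_to_0 :: "(nat \<Rightarrow> graph_map) \<Rightarrow> nat \<Rightarrow> real ^ 2 \<Rightarrow> real ^ 2" where
  "induced_to_0 F 0 = id"
| "induced_to_0 F (Suc n) = induced_to_0 F n \<circ> induced (F n)"

definition homology_core_0 :: "(nat \<Rightarrow> graph_map) \<Rightarrow> (real ^ 2) set" where
  "homology_core_0 F = (\<Inter>n. induced_to_0 F n ` pn_cone)"


subsection \<open>The inverse sequence defining \<open>X(\<alpha>, \<beta>)\<close>\<close>

fun f_map :: "nat \<Rightarrow> nat \<Rightarrow> graph_map" where
  "f_map m n Ea = [Ec]"
| "f_map m n Eb = concat (replicate m [Ec, Ea]) @ concat (replicate (n - 1) [Ec, Eb]) @ [Ec]"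
| "f_map m n Ec = [Eb]"

fun swap_vertex :: "vertex \<Rightarrow> vertex" where
  "swap_vertex Vs = Vt" | "swap_vertex Vt = Vs"

fun edge_path :: "vertex \<Rightarrow> edge list \<Rightarrow> vertex \<Rightarrow> bool" where
  "edge_path v [] w \<longleftrightarrow> v = w"
| "edge_path v (e # p) w \<longleftrightarrow> src e = v \<and> edge_path (tgt e) p w"

lemma edge_path_append: "edge_path u p v \<Longrightarrow> edge_path v q w \<Longrightarrow> edge_path u (p @ q) w"
  by (induction p arbitrary: u) auto

lemma edge_path_f_map: "edge_path (swap_vertex (src e)) (f_map m n e) (swap_vertex (tgt e))"
proof -
  have "edge_path Vt (concat (replicate k [Ec, Ea])) Vt"
    "edge_path Vt (concat (replicate k [Ec, Eb])) Vt" for k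
    by (induction k) simp_all
  moreover have "edge_path Vt [Ec] Vs"
    by simp
  ultimately have "edge_path Vt (f_map m n Eb) Vs"
    unfolding f_map.simps by (blast intro: edge_path_append)
  then show ?thesis
    by (cases e) (simp_all del: f_map.simps(2))
qed

text \<open>The sequence \<open>(a\<^sub>1, a\<^sub>2, \<dots>)\<close> is a function on the natural numbers whose value at \<open>0\<close> is
  irrelevant; it is replaced by \<open>a\<^sub>0 = 1\<close>. The space \<open>X(\<alpha>, \<beta>)\<close> is the inverse limit of the sequence
  \<open>X a b\<close>. Its homology core is defined in terms of this sequence, so the limit is not formed.\<close>

definition with_a0 :: "(nat \<Rightarrow> nat) \<Rightarrow> nat \<Rightarrow> nat" where
  "with_a0 a i = (if i = 0 then 1 else a i)"

definition X :: "(nat \<Rightarrow> nat) \<Rightarrow> (nat \<Rightarrow> nat) \<Rightarrow> nat \<Rightarrow> graph_map" where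
  "X a b i = f_map (with_a0 a i) (b i)"


subsection \<open>Matrices and convergents\<close>

definition f_matrix :: "nat \<Rightarrow> nat \<Rightarrow> real ^ 2 ^ 2" where
  "f_matrix m n = vector [vector [real n, 1], vector [real m, 0]]"

primrec M0 :: "(nat \<Rightarrow> nat) \<Rightarrow> (nat \<Rightarrow> nat) \<Rightarrow> nat \<Rightarrow> real ^ 2 ^ 2" where
  "M0 a b 0 = mat 1"
| "M0 a b (Suc n) = M0 a b n ** f_matrix (with_a0 a n) (b n)"

text \<open>The matrix of convergents with index \<open>k\<close> is the product of the factors \<open>0, \<dots>, k\<close>.\<close>

definition num :: "(nat \<Rightarrow> nat) \<Rightarrow> (nat \<Rightarrow> nat) \<Rightarrow> nat \<Rightarrow> real" where
  "num a b k = M0 a b (Suc k) $ 1 $ 1"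

definition den :: "(nat \<Rightarrow> nat) \<Rightarrow> (nat \<Rightarrow> nat) \<Rightarrow> nat \<Rightarrow> real" where
  "den a b k = M0 a b (Suc k) $ 2 $ 1"

text \<open>The sequence starts at index \<open>1\<close>; the value at \<open>0\<close> is a dummy.\<close>

fun kseq :: "(nat \<Rightarrow> nat) \<Rightarrow> (nat \<Rightarrow> nat) \<Rightarrow> nat \<Rightarrow> real" where
  "kseq a b 0 = 0"
| "kseq a b (Suc 0) = real (b 1) / real (a 1)"
| "kseq a b (Suc (Suc n)) =
     real (b (Suc (Suc n))) * real (b (Suc n)) / (real (a (Suc (Suc n))) * kseq a b (Suc n))"


subsection \<open>Agreement of the homological and the matrix description\<close>

lemma inj_of_coords: "inj of_coords"
proof (rule injI)
  fix v w assume "of_coords v = of_coords w"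
  then have "of_coords v Ea = of_coords w Ea" "of_coords v Eb = of_coords w Eb"
    by simp_all
  then show "v = w"
    by (simp add: of_coords_def path_chain_def vec_eq_iff forall_2)
qed

lemma boundary_simps:
  "boundary x Vs = x Ec - (x Ea + x Eb)" "boundary x Vt = x Ea + x Eb - x Ec"
proof -
  have "tgt e = Vs \<longleftrightarrow> e \<in> {Ec}" "src e = Vs \<longleftrightarrow> e \<in> {Ea, Eb}"
    "tgt e = Vt \<longleftrightarrow> e \<in> {Ea, Eb}" "src e = Vt \<longleftrightarrow> e \<in> {Ec}" for e
    by (cases e; simp)+
  then have "{e. tgt e = Vs} = {Ec}" "{e. src e = Vs} = {Ea, Eb}"
    "{e. tgt e = Vt} = {Ea, Eb}" "{e. src e = Vt} = {Ec}"
    by blast+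
  then show "boundary x Vs = x Ec - (x Ea + x Eb)" "boundary x Vt = x Ea + x Eb - x Ec"
    by (simp_all add: boundary_def)
qed

lemma H1_iff: "x \<in> H1 \<longleftrightarrow> x Ec = x Ea + x Eb"
proof -
  have "x \<in> H1 \<longleftrightarrow> boundary x Vs = 0 \<and> boundary x Vt = 0"
    unfolding H1_def mem_Collect_eq by (intro iffI allI) (simp, case_tac v, simp_all)
  then show ?thesis
    by (auto simp: boundary_simps)
qed

lemma bij_betw_of_coords: "bij_betw of_coords UNIV H1"
proof -
  have "range of_coords = H1"
  proof (intro equalityI subsetI)
    fix x assume "x \<in> range of_coords"
    then show "x \<in> H1"
      by (auto simp: H1_iff of_coords_def path_chain_def)
  next
    fix x assume x: "x \<in> H1"
    have "x e = of_coords (vector [x Eb, x Ea]) e" for e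
      using x by (cases e) (auto simp: H1_iff of_coords_def path_chain_def)
    then have "x = of_coords (vector [x Eb, x Ea])"
      by (rule ext)
    then show "x \<in> range of_coords"
      by (rule range_eqI)
  qed
  then show ?thesis
    by (simp add: bij_betw_def inj_of_coords)
qed

lemma count_list_concat_replicate:
  "count_list (concat (replicate k p)) e = k * count_list p e"
  by (induction k) auto

lemma induced_f_map:
  assumes "0 < n"
  shows "induced (f_map m n) v = f_matrix m n *v v"
proof -
  obtain k where n: "n = Suc k"
    using assms by (cases n) auto
  have mv: "(f_matrix m n *v v) $ 1 = real n * v $ 1 + v $ 2" "(f_matrix m n *v v) $ 2 = real m * v $ 1"
    by (simp_all add: f_matrix_def matrix_vector_mult_def sum_2)
  have cm: "chain_map (f_map m n) x Ea = real m * x Eb"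
    "chain_map (f_map m n) x Eb = real k * x Eb + x Ec"
    "chain_map (f_map m n) x Ec = x Ea + (real m + real k + 1) * x Eb" for x
    by (simp_all add: chain_map_def path_chain_def UNIV_edge count_list_concat_replicate n
          mult.commute)
  have oc: "of_coords w Ea = w $ 2" "of_coords w Eb = w $ 1" "of_coords w Ec = w $ 1 + w $ 2" for w
    by (simp_all add: of_coords_def path_chain_def)
  have "chain_map (f_map m n) (of_coords v) e = of_coords (f_matrix m n *v v) e" for e
  proof (cases e)
    case Ea
    show ?thesis
      unfolding Ea cm oc mv by (rule refl)
  next
    case Eb
    show ?thesis
      unfolding Eb cm oc mv by (simp add: n ring_distribs)
  next
    case Ec
    show ?thesis
      unfolding Ec cm oc mv by (simp add: n ring_distribs)
  qed
  then have "chain_map (f_map m n) (of_coords v) = of_coords (f_matrix m n *v v)"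
    by (rule ext)
  then show ?thesis
    by (simp add: induced_def to_coords_def inj_of_coords)
qed

lemma induced_to_0_X:
  assumes "\<And>i. 0 < b i"
  shows "induced_to_0 (X a b) n = (*v) (M0 a b n)"
proof (induction n)
  case (Suc n)
  then show ?case
    using assms by (auto simp: X_def induced_f_map matrix_vector_mul_assoc)
qed auto

lemma homology_core_0_X:
  assumes "\<And>i. 0 < b i"
  shows "homology_core_0 (X a b) = (\<Inter>n. (*v) (M0 a b n) ` pn_cone)"
  using assms by (simp add: homology_core_0_def induced_to_0_X)

lemma M0_num_den:
  "M0 a b (Suc (Suc k)) = vector [vector [num a b (Suc k), num a b k],
     vector [den a b (Suc k), den a b k]]"
  by (simp add: num_def den_def vec_eq_iff forall_2 f_matrix_def matrix_matrix_mult_def sum_2)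

end

theory Submission
  imports Defs
begin

text \<open>
  The cone \<open>pn_cone\<close> is the union of two opposite closed quadrants, and the columns of
  \<open>M0 a b (k + 2)\<close> consist of the numerators and denominators of the convergents \<open>c (k + 1)\<close> and
  \<open>c k\<close>. Since the denominators are positive, the image of the cone is the double sector
  \<open>sector (c (k + 1)) (c k)\<close> bounded by the lines through \<open>(c (k + 1), 1)\<close> and \<open>(c k, 1)\<close>
  (\<open>matrix_image_pn_cone\<close>). The convergents of even index increase to a limit \<open>lE\<close>, those of odd
  index decrease to a limit \<open>lO\<close>, and every even convergent lies below every odd one. Hence the
  intersection of the nested double sectors is \<open>sector lE lO\<close> (\<open>Inter_sector_alternating\<close>),
  whether or not \<open>lE = lO\<close>; this is the second claim.

  For the first claim it remains to see that \<open>lE = lO\<close> if the series of \<open>kseq a b\<close> diverges, which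
  is one half of the theorem of Seidel and Stern. An equivalence transformation with factors
  \<open>scale a n\<close> turns the partial numerators into \<open>1\<close> and the partial denominators into
  \<open>kseq a b n\<close> for \<open>n \<ge> 1\<close>. If \<open>Q n\<close> are the rescaled denominators, then \<open>c (n + 1)\<close> and \<open>c n\<close>
  differ by \<open>1 / (Q (n + 1) * Q n)\<close> in absolute value, and \<open>Q (n + 1) * Q n\<close> is at least a positive
  constant times a partial sum of the series (\<open>den_scale_lower_bound\<close>). So \<open>lE < lO\<close> would bound
  the partial sums.
\<close>

section \<open>Cones and double sectors\<close>

lemma positive_class_of_coords_nonneg:
  assumes "positive_class (of_coords w)"
  shows "0 \<le> w $ 1" "0 \<le> w $ 2"
proof -
  obtain N :: "edge \<Rightarrow> nat" and y :: "edge \<Rightarrow> nat \<Rightarrow> nat"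
    where *: "\<forall>e. 0 < N e" "\<forall>e. \<forall>j < N e. of_coords w e = real (y e j)"
    using assms unfolding positive_class_def by blast
  have "of_coords w e = real (y e 0)" for e
    using * by blast
  then have "0 \<le> of_coords w Eb" "0 \<le> of_coords w Ea"
    by simp_all
  then show "0 \<le> w $ 1" "0 \<le> w $ 2"
    by (simp_all add: of_coords_def path_chain_def)
qed

lemma positive_class_z1: "positive_class (of_coords (vector [1, 0]))"
  unfolding positive_class_def
proof (intro conjI exI[of _ "\<lambda>_. 1"] exI[of _ "\<lambda>e _. count_list [Ec, Eb] e"])
  show "of_coords (vector [1, 0]) \<in> H1"
    using bij_betw_of_coords by (auto simp: bij_betw_def)
qed (simp_all add: of_coords_def path_chain_def)

lemma positive_class_z2: "positive_class (of_coords (vector [0, 1]))"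
  unfolding positive_class_def
proof (intro conjI exI[of _ "\<lambda>_. 1"] exI[of _ "\<lambda>e _. count_list [Ec, Ea] e"])
  show "of_coords (vector [0, 1]) \<in> H1"
    using bij_betw_of_coords by (auto simp: bij_betw_def)
qed (simp_all add: of_coords_def path_chain_def)

lemma pn_cone_eq:
  "pn_cone = {v. (0 \<le> v $ 1 \<and> 0 \<le> v $ 2) \<or> (v $ 1 \<le> 0 \<and> v $ 2 \<le> 0)}"
proof (intro equalityI subsetI)
  fix v assume "v \<in> pn_cone"
  then obtain k :: nat and r x where v: "v = (\<Sum>i<k. r i *\<^sub>R x i)"
    and x: "\<forall>i<k. positive_class (of_coords (x i))"
    and r: "(\<forall>i<k. 0 \<le> r i) \<or> (\<forall>i<k. r i \<le> 0)"
    unfolding pn_cone_def by blast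
  have x: "0 \<le> x i $ 1" "0 \<le> x i $ 2" if "i < k" for i
    using x that positive_class_of_coords_nonneg by blast+
  have vj: "v $ j = (\<Sum>i<k. r i * x i $ j)" for j
    by (simp add: v)
  show "v \<in> {v. (0 \<le> v $ 1 \<and> 0 \<le> v $ 2) \<or> (v $ 1 \<le> 0 \<and> v $ 2 \<le> 0)}"
    using r
  proof
    assume "\<forall>i<k. 0 \<le> r i"
    then show ?thesis
      unfolding mem_Collect_eq vj by (intro disjI1 conjI sum_nonneg) (simp_all add: x)
  next
    assume "\<forall>i<k. r i \<le> 0"
    then show ?thesis
      unfolding mem_Collect_eq vj
      by (intro disjI2 conjI sum_nonpos) (simp_all add: x mult_nonpos_nonneg)
  qed
next
  fix v :: "real ^ 2"
  assume v: "v \<in> {v. (0 \<le> v $ 1 \<and> 0 \<le> v $ 2) \<or> (v $ 1 \<le> 0 \<and> v $ 2 \<le> 0)}"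
  define r where "r i = (if i = 0 then v $ 1 else v $ 2)" for i :: nat
  define x :: "nat \<Rightarrow> real ^ 2" where "x i = (if i = 0 then vector [1, 0] else vector [0, 1])" for i
  have "v = (\<Sum>i<2. r i *\<^sub>R x i)"
    by (simp add: vec_eq_iff forall_2 r_def x_def numeral_2_eq_2)
  moreover have "\<forall>i<2. positive_class (of_coords (x i))"
    by (simp add: x_def positive_class_z1 positive_class_z2)
  moreover have "(\<forall>i<2. 0 \<le> r i) \<or> (\<forall>i<2. r i \<le> 0)"
    using v by (auto simp: r_def)
  ultimately show "v \<in> pn_cone"
    unfolding pn_cone_def by blast
qed

text \<open>The union of the two opposite closed sectors bounded by the lines through \<open>(l, 1)\<close> and
  \<open>(m, 1)\<close>. The order of \<open>l\<close> and \<open>m\<close> does not matter, and for \<open>l = m\<close> this is a line.\<close>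

definition sector :: "real \<Rightarrow> real \<Rightarrow> (real ^ 2) set" where
  "sector l m = {x *\<^sub>R vector [l, 1] + y *\<^sub>R vector [m, 1] | x y.
     (0 \<le> x \<and> 0 \<le> y) \<or> (x \<le> 0 \<and> y \<le> 0)}"

lemma sector_commute: "sector l m = sector m l"
  unfolding sector_def by (metis (no_types, lifting) add.commute)

lemma sector_same: "sector l l = span {vector [l, 1]}"
proof (intro equalityI subsetI)
  fix v assume "v \<in> sector l l"
  then obtain x y where "v = (x + y) *\<^sub>R vector [l, 1]"
    unfolding sector_def by (auto simp: scaleR_add_left)
  then show "v \<in> span {vector [l, 1]}"
    by (simp add: span_base span_mul)
next
  fix v :: "real ^ 2" assume "v \<in> span {vector [l, 1]}"
  then obtain x where "v = x *\<^sub>R vector [l, 1] + 0 *\<^sub>R vector [l, 1]"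
    by (auto simp: span_singleton)
  moreover have "(0 \<le> x \<and> 0 \<le> (0 :: real)) \<or> (x \<le> 0 \<and> (0 :: real) \<le> 0)"
    by linarith
  ultimately show "v \<in> sector l l"
    unfolding sector_def by blast
qed

lemma mem_sector_iff:
  assumes "l \<le> m"
  shows "v \<in> sector l m \<longleftrightarrow>
    (0 \<le> v $ 2 \<and> l * v $ 2 \<le> v $ 1 \<and> v $ 1 \<le> m * v $ 2) \<or>
    (v $ 2 \<le> 0 \<and> m * v $ 2 \<le> v $ 1 \<and> v $ 1 \<le> l * v $ 2)"
    (is "_ \<longleftrightarrow> ?P v \<or> ?N v")
proof
  assume "v \<in> sector l m"
  then obtain x y where v: "v $ 1 = x * l + y * m" "v $ 2 = x + y"
    and xy: "(0 \<le> x \<and> 0 \<le> y) \<or> (x \<le> 0 \<and> y \<le> 0)"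
    unfolding sector_def by auto
  have "v $ 1 - l * v $ 2 = y * (m - l)" "m * v $ 2 - v $ 1 = x * (m - l)"
    by (simp_all add: v algebra_simps)
  moreover have "0 \<le> m - l"
    using assms by simp
  ultimately show "?P v \<or> ?N v"
    using xy
    by (smt (verit, best) v(2) mult_nonneg_nonneg mult_nonpos_nonneg)
next
  assume *: "?P v \<or> ?N v"
  show "v \<in> sector l m"
  proof (cases "l = m")
    case True
    then have "v = v $ 2 *\<^sub>R vector [l, 1]"
      using * by (auto simp: vec_eq_iff forall_2 mult.commute)
    then have "v \<in> span {vector [l, 1]}"
      by (metis span_base span_mul singletonI)
    then show ?thesis
      using True sector_same by blast
  next
    case False
    define x where "x = (m * v $ 2 - v $ 1) / (m - l)"
    define y where "y = (v $ 1 - l * v $ 2) / (m - l)"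
    have pos: "0 < m - l"
      using False assms by simp
    have "x * l + y * m = ((m * v $ 2 - v $ 1) * l + (v $ 1 - l * v $ 2) * m) / (m - l)"
      by (simp add: x_def y_def add_divide_distrib)
    also have "\<dots> = (m - l) * v $ 1 / (m - l)"
      by (simp add: algebra_simps)
    finally have "x * l + y * m = v $ 1"
      using pos by simp
    moreover have "x + y = (m - l) * v $ 2 / (m - l)"
      by (simp add: x_def y_def algebra_simps flip: add_divide_distrib)
    then have "x + y = v $ 2"
      using pos by simp
    ultimately have "v = x *\<^sub>R vector [l, 1] + y *\<^sub>R vector [m, 1]"
      by (simp add: vec_eq_iff forall_2)
    moreover have "(0 \<le> x \<and> 0 \<le> y) \<or> (x \<le> 0 \<and> y \<le> 0)"
      using * pos by (auto simp: x_def y_def divide_simps)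
    ultimately show ?thesis
      unfolding sector_def by blast
  qed
qed

lemma matrix_image_pn_cone:
  fixes M :: "real ^ 2 ^ 2"
  assumes "0 < M $ 2 $ 1" "0 < M $ 2 $ 2"
  shows "(*v) M ` pn_cone = sector (M $ 1 $ 1 / M $ 2 $ 1) (M $ 1 $ 2 / M $ 2 $ 2)"
proof (intro equalityI subsetI)
  fix v assume "v \<in> (*v) M ` pn_cone"
  then obtain w where w: "(0 \<le> w $ 1 \<and> 0 \<le> w $ 2) \<or> (w $ 1 \<le> 0 \<and> w $ 2 \<le> 0)"
    and v: "v = M *v w"
    by (auto simp: pn_cone_eq)
  let ?x = "w $ 1 * M $ 2 $ 1" and ?y = "w $ 2 * M $ 2 $ 2"
  have "v = ?x *\<^sub>R vector [M $ 1 $ 1 / M $ 2 $ 1, 1] + ?y *\<^sub>R vector [M $ 1 $ 2 / M $ 2 $ 2, 1]"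
    using assms by (simp add: v vec_eq_iff forall_2 matrix_vector_mult_def sum_2)
  moreover have "(0 \<le> ?x \<and> 0 \<le> ?y) \<or> (?x \<le> 0 \<and> ?y \<le> 0)"
    using w assms by (auto intro: mult_nonneg_nonneg mult_nonpos_nonneg)
  ultimately show "v \<in> sector (M $ 1 $ 1 / M $ 2 $ 1) (M $ 1 $ 2 / M $ 2 $ 2)"
    unfolding sector_def by blast
next
  fix v assume "v \<in> sector (M $ 1 $ 1 / M $ 2 $ 1) (M $ 1 $ 2 / M $ 2 $ 2)"
  then obtain x y
    where v: "v = x *\<^sub>R vector [M $ 1 $ 1 / M $ 2 $ 1, 1] + y *\<^sub>R vector [M $ 1 $ 2 / M $ 2 $ 2, 1]"
    and xy: "(0 \<le> x \<and> 0 \<le> y) \<or> (x \<le> 0 \<and> y \<le> 0)"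
    unfolding sector_def by blast
  let ?w = "vector [x / M $ 2 $ 1, y / M $ 2 $ 2] :: real ^ 2"
  have "v = M *v ?w"
    using assms by (simp add: v vec_eq_iff forall_2 matrix_vector_mult_def sum_2 mult.commute)
  moreover have "?w \<in> pn_cone"
    using xy assms by (auto simp: pn_cone_eq divide_simps)
  ultimately show "v \<in> (*v) M ` pn_cone"
    by blast
qed

lemma f_matrix_image_pn_cone: "(*v) (f_matrix m n) ` pn_cone \<subseteq> pn_cone"
proof
  fix v assume "v \<in> (*v) (f_matrix m n) ` pn_cone"
  then obtain w :: "real ^ 2"
    where w: "(0 \<le> w $ 1 \<and> 0 \<le> w $ 2) \<or> (w $ 1 \<le> 0 \<and> w $ 2 \<le> 0)"
      and "v = f_matrix m n *v w"
    unfolding pn_cone_eq by blast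
  then have v: "v $ 1 = real n * w $ 1 + w $ 2" "v $ 2 = real m * w $ 1"
    by (simp_all add: f_matrix_def matrix_vector_mult_def sum_2)
  show "v \<in> pn_cone"
    using w
  proof
    assume "0 \<le> w $ 1 \<and> 0 \<le> w $ 2"
    then show ?thesis
      by (simp add: pn_cone_eq v)
  next
    assume "w $ 1 \<le> 0 \<and> w $ 2 \<le> 0"
    then show ?thesis
      by (simp add: pn_cone_eq v add_nonpos_nonpos mult_nonneg_nonpos)
  qed
qed

text \<open>The nesting allows the images under \<open>M0 a b 0\<close> and \<open>M0 a b 1\<close>, matrices whose bottom
  rows have a zero entry, to be dropped from the intersection defining the core.\<close>

lemma decseq_M0_image_pn_cone: "decseq (\<lambda>n. (*v) (M0 a b n) ` pn_cone)"
proof (rule decseq_SucI)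
  fix n
  have "(*v) (M0 a b (Suc n)) ` pn_cone
      = (*v) (M0 a b n) ` (*v) (f_matrix (with_a0 a n) (b n)) ` pn_cone"
    by (simp add: image_image matrix_vector_mul_assoc)
  then show "(*v) (M0 a b (Suc n)) ` pn_cone \<subseteq> (*v) (M0 a b n) ` pn_cone"
    using f_matrix_image_pn_cone by (simp add: image_mono)
qed

lemma LIMSEQ_if_even_odd:
  fixes c :: "nat \<Rightarrow> 'a :: metric_space"
  assumes E: "(\<lambda>n. c (2 * n)) \<longlonglongrightarrow> l" and O: "(\<lambda>n. c (2 * n + 1)) \<longlonglongrightarrow> l"
  shows "c \<longlonglongrightarrow> l"
proof (rule metric_LIMSEQ_I)
  fix e :: real assume e: "0 < e"
  obtain N where N: "\<And>n. N \<le> n \<Longrightarrow> dist (c (2 * n)) l < e"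
    using metric_LIMSEQ_D[OF E e] by blast
  obtain N' where N': "\<And>n. N' \<le> n \<Longrightarrow> dist (c (2 * n + 1)) l < e"
    using metric_LIMSEQ_D[OF O e] by blast
  have "dist (c n) l < e" if "2 * (N + N') + 1 \<le> n" for n
  proof (cases "even n")
    case True
    then obtain k where "n = 2 * k" ..
    then show ?thesis
      using N[of k] that by simp
  next
    case False
    then obtain k where "n = 2 * k + 1"
      by (elim oddE)
    then show ?thesis
      using N'[of k] that by simp
  qed
  then show "\<exists>M. \<forall>n\<ge>M. dist (c n) l < e"
    by blast
qed

lemma Inter_sector_alternating:
  fixes c :: "nat \<Rightarrow> real"
  assumes inc: "incseq (\<lambda>n. c (2 * n))" and dec: "decseq (\<lambda>n. c (2 * n + 1))"
    and le: "\<And>n. c (2 * n) \<le> c (2 * n + 1)"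
    and lE: "(\<lambda>n. c (2 * n)) \<longlonglongrightarrow> lE" and lO: "(\<lambda>n. c (2 * n + 1)) \<longlonglongrightarrow> lO"
  shows "(\<Inter>n. sector (c (Suc n)) (c n)) = sector lE lO"
proof (intro equalityI subsetI)
  have lElO: "lE \<le> lO"
    using LIMSEQ_le[OF lE lO] le by blast
  fix v
  {
    assume v: "v \<in> (\<Inter>n. sector (c (Suc n)) (c n))"
    have "v \<in> sector (c (2 * n)) (c (2 * n + 1))" for n
      using INT_D[OF v, of "2 * n"] by (simp add: sector_commute)
    then have *: "(0 \<le> v $ 2 \<and> c (2 * n) * v $ 2 \<le> v $ 1 \<and> v $ 1 \<le> c (2 * n + 1) * v $ 2) \<or>
      (v $ 2 \<le> 0 \<and> c (2 * n + 1) * v $ 2 \<le> v $ 1 \<and> v $ 1 \<le> c (2 * n) * v $ 2)" for n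
      using mem_sector_iff[OF le] by blast
    have E: "(\<lambda>n. c (2 * n) * v $ 2) \<longlonglongrightarrow> lE * v $ 2"
      and O: "(\<lambda>n. c (2 * n + 1) * v $ 2) \<longlonglongrightarrow> lO * v $ 2"
      by (intro tendsto_mult_right lE lO)+
    show "v \<in> sector lE lO"
    proof (cases "0 \<le> v $ 2")
      case True
      then have "c (2 * n) * v $ 2 \<le> v $ 1 \<and> v $ 1 \<le> c (2 * n + 1) * v $ 2" for n
        using *[of n] by auto
      then have "lE * v $ 2 \<le> v $ 1" "v $ 1 \<le> lO * v $ 2"
        using LIMSEQ_le_const2[OF E] LIMSEQ_le_const[OF O] by blast+
      then show ?thesis
        using True mem_sector_iff[OF lElO] by blast
    next
      case False
      then have "c (2 * n + 1) * v $ 2 \<le> v $ 1 \<and> v $ 1 \<le> c (2 * n) * v $ 2" for n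
        using *[of n] by auto
      then have "lO * v $ 2 \<le> v $ 1" "v $ 1 \<le> lE * v $ 2"
        using LIMSEQ_le_const[OF E] LIMSEQ_le_const2[OF O] by blast+
      then show ?thesis
        using False mem_sector_iff[OF lElO] by fastforce
    qed
  }
  {
    assume v: "v \<in> sector lE lO"
    have mono: "v \<in> sector l m" if "l \<le> lE" "lO \<le> m" for l m
    proof -
      have lm: "l \<le> m"
        using that lElO by linarith
      show ?thesis
        using v that unfolding mem_sector_iff[OF lElO] mem_sector_iff[OF lm]
        by (meson mult_right_mono mult_right_mono_neg order_trans)
    qed
    have E: "c (2 * n) \<le> lE" and O: "lO \<le> c (2 * n + 1)" for n
      using incseq_le[OF inc lE] decseq_ge[OF dec lO] by blast+
    have "v \<in> sector (c (Suc n)) (c n)" for n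
    proof (cases "even n")
      case True
      then obtain k where "n = 2 * k" ..
      then show ?thesis
        using mono[OF E[of k] O[of k]] by (simp add: sector_commute)
    next
      case False
      then obtain k where "n = 2 * k + 1"
        by (elim oddE)
      then show ?thesis
        using mono[OF E[of "Suc k"] O[of k]] by simp
    qed
    then show "v \<in> (\<Inter>n. sector (c (Suc n)) (c n))"
      by blast
  }
qed


section \<open>Convergents of a continued fraction with positive entries\<close>

lemma num_0: "num a b 0 = real (b 0)"
  and den_0: "den a b 0 = 1"
  by (simp_all add: num_def den_def f_matrix_def with_a0_def)

lemma num_Suc_0: "num a b (Suc 0) = real (b 0) * real (b 1) + real (a 1)"
  and den_Suc_0: "den a b (Suc 0) = real (b 1)"
  by (simp_all add: num_def den_def f_matrix_def with_a0_def matrix_matrix_mult_def sum_2 mat_def)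

lemma num_Suc_Suc:
  "num a b (Suc (Suc n)) = real (b (Suc (Suc n))) * num a b (Suc n) + real (a (Suc (Suc n))) * num a b n"
proof -
  have "num a b (Suc (Suc n))
      = (M0 a b (Suc (Suc n)) ** f_matrix (with_a0 a (Suc (Suc n))) (b (Suc (Suc n)))) $ 1 $ 1"
    by (simp only: num_def M0.simps(2))
  then show ?thesis
    by (simp add: M0_num_den f_matrix_def with_a0_def matrix_matrix_mult_def sum_2 mult.commute
        del: M0.simps)
qed

lemma den_Suc_Suc:
  "den a b (Suc (Suc n)) = real (b (Suc (Suc n))) * den a b (Suc n) + real (a (Suc (Suc n))) * den a b n"
proof -
  have "den a b (Suc (Suc n))
      = (M0 a b (Suc (Suc n)) ** f_matrix (with_a0 a (Suc (Suc n))) (b (Suc (Suc n)))) $ 2 $ 1"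
    by (simp only: den_def M0.simps(2))
  then show ?thesis
    by (simp add: M0_num_den f_matrix_def with_a0_def matrix_matrix_mult_def sum_2 mult.commute
        del: M0.simps)
qed

text \<open>The factors of the equivalence transformation to partial numerators \<open>1\<close>: they are chosen
  such that \<open>num a b n / scale a n\<close> and \<open>den a b n / scale a n\<close> satisfy the recurrence
  \<open>u (n + 2) = kseq a b (n + 2) * u (n + 1) + u n\<close>.\<close>

fun scale :: "(nat \<Rightarrow> nat) \<Rightarrow> nat \<Rightarrow> real" where
  "scale a 0 = 1"
| "scale a (Suc 0) = real (a 1)"
| "scale a (Suc (Suc n)) = real (a (Suc (Suc n))) * scale a n"

locale positive_continued_fraction =
  fixes a b :: "nat \<Rightarrow> nat"
  assumes a_pos: "\<And>i. 1 \<le> i \<Longrightarrow> 0 < a i"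
    and b_pos: "\<And>i. 0 < b i"
begin

text \<open>The convergents.\<close>

definition c :: "nat \<Rightarrow> real" where
  "c n = num a b n / den a b n"

lemma den_pos: "0 < den a b n"
proof (induction n rule: induct_nat_012)
  case (ge2 n)
  then show ?case
    by (simp add: den_Suc_Suc a_pos b_pos add_pos_pos)
qed (simp_all add: den_0 den_Suc_0 b_pos)

lemma scale_pos: "0 < scale a n"
  by (induction n rule: induct_nat_012) (simp_all add: a_pos)

lemma kseq_eq_scale: "kseq a b (Suc n) = real (b (Suc n)) * scale a n / scale a (Suc n)"
proof (induction n)
  case (Suc n)
  have "0 < b (Suc n)"
    by (simp add: b_pos)
  then show ?case
    using scale_pos[of n] scale_pos[of "Suc n"]
    unfolding kseq.simps(3) Suc.IH scale.simps(3) by (simp add: divide_simps)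
qed simp

lemma kseq_pos: "0 < kseq a b (Suc n)"
  by (simp add: kseq_eq_scale scale_pos b_pos del: scale.simps)

text \<open>The determinant formula for \<open>M0 a b (n + 2)\<close>. The product of the \<open>a i\<close> for \<open>1 \<le> i \<le> n + 1\<close> appears
  in it as \<open>scale a (n + 1) * scale a n\<close>.\<close>

lemma num_den_determinant:
  "num a b (Suc n) * den a b n - num a b n * den a b (Suc n) = (- 1) ^ n * scale a (Suc n) * scale a n"
proof (induction n)
  case 0
  show ?case
    by (simp add: num_0 den_0 num_Suc_0 den_Suc_0)
next
  case (Suc n)
  have "num a b (Suc (Suc n)) * den a b (Suc n) - num a b (Suc n) * den a b (Suc (Suc n))
      = - real (a (Suc (Suc n))) * (num a b (Suc n) * den a b n - num a b n * den a b (Suc n))"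
    by (simp add: num_Suc_Suc den_Suc_Suc algebra_simps)
  then show ?case
    by (simp add: Suc)
qed

lemma c_diff_Suc:
  "c (Suc n) - c n = (- 1) ^ n * (scale a (Suc n) * scale a n / (den a b (Suc n) * den a b n))"
proof -
  have "c (Suc n) - c n
      = (num a b (Suc n) * den a b n - num a b n * den a b (Suc n)) / (den a b (Suc n) * den a b n)"
    using den_pos[of n] den_pos[of "Suc n"] by (simp add: c_def field_simps)
  then show ?thesis
    by (simp add: num_den_determinant mult.assoc del: scale.simps)
qed

lemma c_diff_Suc_Suc:
  "c (Suc (Suc n)) - c n
    = (- 1) ^ n * (real (b (Suc (Suc n))) * scale a (Suc n) * scale a n / (den a b (Suc (Suc n)) * den a b n))"
proof -
  have "num a b (Suc (Suc n)) * den a b n - num a b n * den a b (Suc (Suc n))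
      = real (b (Suc (Suc n))) * (num a b (Suc n) * den a b n - num a b n * den a b (Suc n))"
    by (simp add: num_Suc_Suc den_Suc_Suc algebra_simps)
  moreover have "c (Suc (Suc n)) - c n
      = (num a b (Suc (Suc n)) * den a b n - num a b n * den a b (Suc (Suc n)))
        / (den a b (Suc (Suc n)) * den a b n)"
    using den_pos[of n] den_pos[of "Suc (Suc n)"] by (simp add: c_def field_simps)
  ultimately have "c (Suc (Suc n)) - c n
      = real (b (Suc (Suc n))) * ((- 1) ^ n * scale a (Suc n) * scale a n)
        / (den a b (Suc (Suc n)) * den a b n)"
    by (simp only: num_den_determinant)
  then show ?thesis
    by (simp add: ac_simps del: scale.simps)
qed

lemma incseq_c_even: "incseq (\<lambda>n. c (2 * n))"
proof (rule incseq_SucI)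
  fix n
  have "0 \<le> c (Suc (Suc (2 * n))) - c (2 * n)"
    unfolding c_diff_Suc_Suc by (simp add: less_imp_le scale_pos den_pos del: scale.simps)
  then show "c (2 * n) \<le> c (2 * Suc n)"
    by simp
qed

lemma decseq_c_odd: "decseq (\<lambda>n. c (2 * n + 1))"
proof (rule decseq_SucI)
  fix n
  have "c (Suc (Suc (2 * n + 1))) - c (2 * n + 1) \<le> 0"
    unfolding c_diff_Suc_Suc by (simp add: less_imp_le scale_pos den_pos del: scale.simps)
  then show "c (2 * Suc n + 1) \<le> c (2 * n + 1)"
    by simp
qed

lemma c_even_le_odd: "c (2 * n) \<le> c (2 * n + 1)"
proof -
  have "0 \<le> c (Suc (2 * n)) - c (2 * n)"
    unfolding c_diff_Suc by (simp add: less_imp_le scale_pos den_pos del: scale.simps)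
  then show ?thesis
    by simp
qed

lemma c_even_odd_limits:
  obtains lE lO where "(\<lambda>n. c (2 * n)) \<longlonglongrightarrow> lE" "(\<lambda>n. c (2 * n + 1)) \<longlonglongrightarrow> lO"
proof -
  have "c (2 * n) \<le> c 1" for n
    using c_even_le_odd[of n] decseqD[OF decseq_c_odd, of 0 n] by simp
  then obtain lE where lE: "(\<lambda>n. c (2 * n)) \<longlonglongrightarrow> lE"
    using incseq_convergent[OF incseq_c_even] by blast
  have "c 0 \<le> c (2 * n + 1)" for n
    using c_even_le_odd[of n] incseqD[OF incseq_c_even, of 0 n] by simp
  then obtain lO where lO: "(\<lambda>n. c (2 * n + 1)) \<longlonglongrightarrow> lO"
    using decseq_convergent[OF decseq_c_odd] by blast
  show thesis
    using that lE lO .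
qed

text \<open>A bound on consecutive rescaled denominators; together with \<open>c_diff_Suc\<close> it forces the
  convergents together if \<open>kseq a b\<close> has unbounded partial sums.\<close>

lemma den_scale_lower_bound:
  obtains K where "0 < K"
    "\<And>n. K * (\<Sum>i<n. kseq a b (Suc i)) \<le> den a b (Suc n) * den a b n / (scale a (Suc n) * scale a n)"
proof -
  define Q where "Q n = den a b n / scale a n" for n
  have Q_Suc_0: "Q (Suc 0) = kseq a b (Suc 0)" and Q_0: "Q 0 = 1"
    by (simp_all add: Q_def den_0 den_Suc_0)
  have Q_Suc_Suc: "Q (Suc (Suc n)) = kseq a b (Suc (Suc n)) * Q (Suc n) + Q n" for n
    using scale_pos[of n] scale_pos[of "Suc n"] a_pos[of "Suc (Suc n)"]
    unfolding Q_def kseq_eq_scale den_Suc_Suc by (simp add: field_simps)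
  have Q_pos: "0 < Q n" for n
    by (simp add: Q_def den_pos scale_pos)
  \<comment> \<open>As \<open>Q (n + 2) \<ge> Q n\<close>, the smaller of \<open>Q 0\<close> and \<open>Q 1\<close> bounds all \<open>Q n\<close> from below.\<close>
  define m where "m = min 1 (kseq a b (Suc 0))"
  have m_pos: "0 < m"
    using kseq_pos[of 0] by (simp add: m_def)
  have m_le: "m \<le> Q n" for n
  proof (induction n rule: induct_nat_012)
    case (ge2 n)
    have "0 \<le> kseq a b (Suc (Suc n)) * Q (Suc n)"
      using kseq_pos[of "Suc n"] Q_pos[of "Suc n"] by (simp del: kseq.simps)
    then show ?case
      using ge2 by (simp add: Q_Suc_Suc del: kseq.simps)
  qed (simp_all add: Q_0 Q_Suc_0 m_def)
  show thesis
  proof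
    show "0 < m\<^sup>2"
      using m_pos by simp
    fix n
    \<comment> \<open>Multiplying the recurrence by \<open>Q (n + 1)\<close> shows that the product grows by
      \<open>kseq a b (n + 2) * (Q (n + 1))\<^sup>2\<close> in each step.\<close>
    have "m\<^sup>2 * (\<Sum>i<Suc n. kseq a b (Suc i)) \<le> Q (Suc n) * Q n"
    proof (induction n)
      case 0
      have "m\<^sup>2 \<le> 1"
        using m_pos by (simp add: m_def power_le_one)
      then show ?case
        using kseq_pos[of 0] by (simp add: Q_0 Q_Suc_0 mult_le_cancel_right1 del: kseq.simps)
    next
      case (Suc n)
      have "m\<^sup>2 * kseq a b (Suc (Suc n)) \<le> (Q (Suc n))\<^sup>2 * kseq a b (Suc (Suc n))"
        using m_pos m_le kseq_pos[of "Suc n"] by (intro mult_right_mono power_mono) simp_all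
      then have "m\<^sup>2 * (\<Sum>i<Suc (Suc n). kseq a b (Suc i))
          \<le> Q (Suc n) * Q n + (Q (Suc n))\<^sup>2 * kseq a b (Suc (Suc n))"
        using Suc by (simp add: distrib_left del: kseq.simps)
      also have "\<dots> = Q (Suc (Suc n)) * Q (Suc n)"
        by (simp add: Q_Suc_Suc algebra_simps power2_eq_square del: kseq.simps)
      finally show ?case .
    qed
    moreover have "m\<^sup>2 * (\<Sum>i<n. kseq a b (Suc i)) \<le> m\<^sup>2 * (\<Sum>i<Suc n. kseq a b (Suc i))"
      using kseq_pos[of n] by (intro mult_left_mono) (simp_all del: kseq.simps)
    ultimately show "m\<^sup>2 * (\<Sum>i<n. kseq a b (Suc i))
        \<le> den a b (Suc n) * den a b n / (scale a (Suc n) * scale a n)"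
      by (simp add: Q_def del: kseq.simps scale.simps)
  qed
qed

text \<open>One half of the theorem of Seidel and Stern.\<close>

lemma c_limits_eq_if_not_summable:
  assumes not_summable: "\<not> summable (\<lambda>n. kseq a b (Suc n))"
    and lE: "(\<lambda>n. c (2 * n)) \<longlonglongrightarrow> lE" and lO: "(\<lambda>n. c (2 * n + 1)) \<longlonglongrightarrow> lO"
  shows "lE = lO"
proof (rule ccontr)
  assume "lE \<noteq> lO"
  moreover have "lE \<le> lO"
    using LIMSEQ_le[OF lE lO] c_even_le_odd by blast
  ultimately have d: "0 < lO - lE"
    by simp
  obtain K where K: "0 < K"
    "\<And>n. K * (\<Sum>i<n. kseq a b (Suc i)) \<le> den a b (Suc n) * den a b n / (scale a (Suc n) * scale a n)"
    using den_scale_lower_bound by blast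
  have bound: "(\<Sum>i<2 * n. kseq a b (Suc i)) \<le> 1 / (K * (lO - lE))" for n
  proof -
    let ?S = "scale a (Suc (2 * n)) * scale a (2 * n)"
    let ?D = "den a b (Suc (2 * n)) * den a b (2 * n)"
    have "lO - lE \<le> c (Suc (2 * n)) - c (2 * n)"
      using incseq_le[OF incseq_c_even lE, of n] decseq_ge[OF decseq_c_odd lO, of n] by simp
    then have "lO - lE \<le> ?S / ?D"
      unfolding c_diff_Suc by (simp del: scale.simps)
    then have "inverse (?S / ?D) \<le> inverse (lO - lE)"
      using d by (rule le_imp_inverse_le)
    then have "?D / ?S \<le> 1 / (lO - lE)"
      by (simp only: inverse_divide inverse_eq_divide[of "lO - lE"])
    then have "K * (\<Sum>i<2 * n. kseq a b (Suc i)) \<le> 1 / (lO - lE)"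
      using K(2)[of "2 * n"] by linarith
    then show ?thesis
      using K(1) d by (simp add: field_simps)
  qed
  have "summable (\<lambda>n. kseq a b (Suc n))"
  proof (rule summableI_nonneg_bounded)
    show "0 \<le> kseq a b (Suc n)" for n
      using kseq_pos[of n] by simp
    show "(\<Sum>i<n. kseq a b (Suc i)) \<le> 1 / (K * (lO - lE))" for n
    proof -
      have "(\<Sum>i<n. kseq a b (Suc i)) \<le> (\<Sum>i<2 * n. kseq a b (Suc i))"
        using kseq_pos by (intro sum_mono2) (auto intro: less_imp_le)
      then show ?thesis
        using bound[of n] by linarith
    qed
  qed
  then show False
    using not_summable by contradiction
qed


section \<open>The homology core\<close>

lemma homology_core_0_eq_Inter_sector:
  "homology_core_0 (X a b) = (\<Inter>n. sector (c (Suc n)) (c n))"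
proof -
  have "(*v) (M0 a b (Suc (Suc n))) ` pn_cone = sector (c (Suc n)) (c n)" for n
    using matrix_image_pn_cone[of "M0 a b (Suc (Suc n))"] den_pos[of n] den_pos[of "Suc n"]
    by (simp add: M0_num_den c_def del: M0.simps)
  moreover have "(\<Inter>n. (*v) (M0 a b n) ` pn_cone) = (\<Inter>n. (*v) (M0 a b (Suc (Suc n))) ` pn_cone)"
  proof
    have "(*v) (M0 a b (Suc (Suc n))) ` pn_cone \<subseteq> (*v) (M0 a b n) ` pn_cone" for n
      using decseqD[OF decseq_M0_image_pn_cone, of n "Suc (Suc n)"] by simp
    then show "(\<Inter>n. (*v) (M0 a b (Suc (Suc n))) ` pn_cone) \<subseteq> (\<Inter>n. (*v) (M0 a b n) ` pn_cone)"
      by blast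
  qed blast
  ultimately show ?thesis
    using homology_core_0_X[OF b_pos] by simp
qed

lemma homology_core_0_eq_sector:
  assumes "(\<lambda>n. c (2 * n)) \<longlonglongrightarrow> lE" "(\<lambda>n. c (2 * n + 1)) \<longlonglongrightarrow> lO"
  shows "homology_core_0 (X a b) = sector lE lO"
  using Inter_sector_alternating[OF incseq_c_even decseq_c_odd c_even_le_odd assms]
  by (simp add: homology_core_0_eq_Inter_sector)

end

theorem proposition6p9:
  fixes a b :: "nat \<Rightarrow> nat"
  assumes "\<And>i. 1 \<le> i \<Longrightarrow> 0 < a i"
    and "\<And>i. 0 < b i"
  shows
    "(\<not> summable (\<lambda>n. kseq a b (Suc n)) \<longrightarrow>
       (\<exists>l. (\<lambda>n. num a b n / den a b n) \<longlonglongrightarrow> l \<and>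
          homology_core_0 (X a b) = span {vector [l, 1]})) \<and>
     (summable (\<lambda>n. kseq a b (Suc n)) \<longrightarrow>
       (\<exists>lE lO. (\<lambda>n. num a b (2 * n) / den a b (2 * n)) \<longlonglongrightarrow> lE \<and>
          (\<lambda>n. num a b (2 * n + 1) / den a b (2 * n + 1)) \<longlonglongrightarrow> lO \<and>
          homology_core_0 (X a b) =
            {x *\<^sub>R vector [lE, 1] + y *\<^sub>R vector [lO, 1] | x y.
               (0 \<le> x \<and> 0 \<le> y) \<or> (x \<le> 0 \<and> y \<le> 0)}))"
proof -
  interpret positive_continued_fraction a b
    using assms by unfold_locales
  obtain lE lO where lE: "(\<lambda>n. c (2 * n)) \<longlonglongrightarrow> lE" and lO: "(\<lambda>n. c (2 * n + 1)) \<longlonglongrightarrow> lO"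
    by (rule c_even_odd_limits)
  have core: "homology_core_0 (X a b) = sector lE lO"
    using homology_core_0_eq_sector[OF lE lO] .
  show ?thesis
  proof (intro conjI impI)
    assume "\<not> summable (\<lambda>n. kseq a b (Suc n))"
    then have eq: "lE = lO"
      using lE lO by (rule c_limits_eq_if_not_summable)
    have "c \<longlonglongrightarrow> lE"
      using LIMSEQ_if_even_odd[OF lE lO[folded eq]] .
    then have "(\<lambda>n. num a b n / den a b n) \<longlonglongrightarrow> lE"
      by (simp add: c_def[abs_def])
    moreover have "homology_core_0 (X a b) = span {vector [lE, 1]}"
      using core eq sector_same by simp
    ultimately show "\<exists>l. (\<lambda>n. num a b n / den a b n) \<longlonglongrightarrow> l \<and>
        homology_core_0 (X a b) = span {vector [l, 1]}"
      by blast
  next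
    show "\<exists>lE lO. (\<lambda>n. num a b (2 * n) / den a b (2 * n)) \<longlonglongrightarrow> lE \<and>
        (\<lambda>n. num a b (2 * n + 1) / den a b (2 * n + 1)) \<longlonglongrightarrow> lO \<and>
        homology_core_0 (X a b) =
          {x *\<^sub>R vector [lE, 1] + y *\<^sub>R vector [lO, 1] | x y.
             (0 \<le> x \<and> 0 \<le> y) \<or> (x \<le> 0 \<and> y \<le> 0)}"
      using lE lO core unfolding c_def sector_def by blast
  qed
qed

end
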